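(* Let $(X,\tau)$ be a metrizable locally solid vector lattice. If $X$ has a weak unit, then the $u\tau$-topology on $X$ is submetrizable.
   Context: A locally solid vector lattice $(X,\tau)$ is a (real) vector lattice $X$ with a Hausdorff linear topology $\tau$ that has a base at zero consisting of solid sets (a set $A$ is solid if $|x|\le|y|$ and $y\in A$ imply $x\in A$). $X_+$ is the positive cone. The $u\tau$-topology is the locally solid topology on $X$ having as a neighborhood base at zero the sets $U_{V,w}=\{x\in X:|x|\wedge w\in V\}$, where $V$ runs over a base of solid $\tau$-neighborhoods of zero and $0\ne w\in X_+$; a net $x_\alpha$ converges to $x$ in it iff $|x_\alpha-x|\wedge w\to 0$ in $\tau$ for all $w\in X_+$. An element $0\ne e\in X_+$ is a weak unit if the band $B_e$ generated by $e$ is $X$ (equivalently, $x\wedge ne\uparrow x$ for every $x\in X_+$). A topological space is submetrizable if its topology is finer than (i.e. contains) some metric topology on the same set. *)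

theory Defs
  imports "HOL-Analysis.Analysis" "HOL-Library.Lattice_Algebras" "HOL-Library.Lub_Glb"
begin

class vector_lattice = ordered_real_vector + lattice_ab_group_add_abs

definition solid :: "'a::vector_lattice set \<Rightarrow> bool" where
  "solid A \<longleftrightarrow> (\<forall>x y. \<bar>x\<bar> \<le> \<bar>y\<bar> \<and> y \<in> A \<longrightarrow> x \<in> A)"

definition linear_topology :: "'a::real_vector topology \<Rightarrow> bool" where
  "linear_topology T \<longleftrightarrow>
     topspace T = UNIV \<and>
     continuous_map (prod_topology T T) T (\<lambda>(x, y). x + y) \<and>
     continuous_map (prod_topology euclideanreal T) T (\<lambda>(c, x). c *\<^sub>R x)"

definition locally_solid :: "'a::vector_lattice topology \<Rightarrow> bool" where
  "locally_solid T \<longleftrightarrow>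
     linear_topology T \<and> Hausdorff_space T \<and> neighbourhood_base_at 0 solid T"

(* Neighbourhoods need not be open. *)
definition solid_nhd :: "'a::vector_lattice topology \<Rightarrow> 'a set \<Rightarrow> bool" where
  "solid_nhd T V \<longleftrightarrow> solid V \<and> 0 \<in> T interior_of V"

definition u_nhd :: "'a::vector_lattice set \<Rightarrow> 'a \<Rightarrow> 'a set" where
  "u_nhd V w = {x. inf \<bar>x\<bar> w \<in> V}"

definition u_open :: "'a::vector_lattice topology \<Rightarrow> 'a set \<Rightarrow> bool" where
  "u_open T G \<longleftrightarrow>
     (\<forall>x\<in>G. \<exists>V w. solid_nhd T V \<and> 0 \<le> w \<and> w \<noteq> 0 \<and> (+) x ` u_nhd V w \<subseteq> G)"

(* The translates of the sets u_nhd V w generate the topology. On the zero space there is no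
   w with w > 0, so there the result is the topology with empty carrier. *)
definition u_topology :: "'a::vector_lattice topology \<Rightarrow> 'a topology" where
  "u_topology T = topology (u_open T)"

lemma solid_nhd_Int: "solid_nhd T V \<Longrightarrow> solid_nhd T V' \<Longrightarrow> solid_nhd T (V \<inter> V')"
  unfolding solid_nhd_def solid_def interior_of_Int by blast

lemma u_nhd_mono:
  fixes w w' :: "'a::vector_lattice"
  assumes "solid V'" "V' \<subseteq> V" "0 \<le> w" "w \<le> w'"
  shows "u_nhd V' w' \<subseteq> u_nhd V w"
proof
  fix x assume "x \<in> u_nhd V' w'"
  then have *: "inf \<bar>x\<bar> w' \<in> V'" by (simp add: u_nhd_def)
  have "0 \<le> inf \<bar>x\<bar> w" "inf \<bar>x\<bar> w \<le> inf \<bar>x\<bar> w'"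
    using assms by (auto intro: le_infI2)
  then have "\<bar>inf \<bar>x\<bar> w\<bar> \<le> \<bar>inf \<bar>x\<bar> w'\<bar>"
    by (metis abs_of_nonneg order_trans)
  with * assms(1,2) show "x \<in> u_nhd V w"
    unfolding u_nhd_def solid_def by blast
qed

lemma istopology_u_open: "istopology (u_open T)"
  unfolding istopology_def
proof (intro conjI allI impI)
  fix G H assume G: "u_open T G" and H: "u_open T H"
  show "u_open T (G \<inter> H)"
    unfolding u_open_def
  proof
    fix x assume "x \<in> G \<inter> H"
    then have "x \<in> G" "x \<in> H" by simp_all
    obtain V w where 1: "solid_nhd T V" "0 \<le> w" "w \<noteq> 0" "(+) x ` u_nhd V w \<subseteq> G"
      using G \<open>x \<in> G\<close> unfolding u_open_def by blast
    obtain V' w' where 2: "solid_nhd T V'" "0 \<le> w'" "w' \<noteq> 0" "(+) x ` u_nhd V' w' \<subseteq> H"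
      using H \<open>x \<in> H\<close> unfolding u_open_def by blast
    have s: "solid_nhd T (V \<inter> V')" using 1 2 by (simp add: solid_nhd_Int)
    then have "u_nhd (V \<inter> V') (sup w w') \<subseteq> u_nhd V w \<inter> u_nhd V' w'"
      using 1(2) 2(2) by (intro Int_greatest u_nhd_mono) (auto simp: solid_nhd_def)
    then have "(+) x ` u_nhd (V \<inter> V') (sup w w') \<subseteq> G \<inter> H"
      using 1(4) 2(4) by blast
    moreover have "0 \<le> sup w w'" "sup w w' \<noteq> 0"
      using 1(2,3) 2(2) by (auto intro: le_supI1) (metis order.antisym sup_ge1)
    ultimately show "\<exists>V w. solid_nhd T V \<and> 0 \<le> w \<and> w \<noteq> 0 \<and> (+) x ` u_nhd V w \<subseteq> G \<inter> H"
      using s by blast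
  qed
next
  fix K assume "\<forall>G\<in>K. u_open T G"
  then show "u_open T (\<Union>K)"
    unfolding u_open_def by (meson Union_iff Union_upper subset_trans)
qed

lemma openin_u_topology: "openin (u_topology T) G \<longleftrightarrow> u_open T G"
  by (simp add: u_topology_def istopology_u_open)

lemma solid_nhd_half:
  assumes T: "locally_solid T" and V: "solid_nhd T V"
  shows "\<exists>W. solid_nhd T W \<and> (\<forall>a\<in>W. \<forall>b\<in>W. a + b \<in> V)"
proof -
  let ?P = "{p \<in> topspace (prod_topology T T). (case p of (x, y) \<Rightarrow> x + y) \<in> T interior_of V}"
  have P: "openin (prod_topology T T) ?P"
    using T unfolding locally_solid_def linear_topology_def
    by (intro openin_continuous_map_preimage[where Y = T] openin_interior_of) simp
  have Z: "(0, 0) \<in> ?P"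
    using T V by (auto simp: locally_solid_def linear_topology_def solid_nhd_def)
  obtain A B where AB: "openin T A" "openin T B" "0 \<in> A" "0 \<in> B" "A \<times> B \<subseteq> ?P"
    using openin_prod_topology_alt[THEN iffD1, rule_format, OF P Z] by (elim exE conjE) (rule that)
  then have "openin T (A \<inter> B)" "0 \<in> A \<inter> B" by auto
  then obtain U W where W: "openin T U" "solid W" "0 \<in> U" "U \<subseteq> W" "W \<subseteq> A \<inter> B"
    using T unfolding locally_solid_def neighbourhood_base_at_def by metis
  have "0 \<in> T interior_of W"
    using interior_of_maximal[OF W(4,1)] W(3) by (rule subsetD)
  then have "solid_nhd T W"
    using W(2) by (simp add: solid_nhd_def)
  moreover have "a + b \<in> V" if "a \<in> W" "b \<in> W" for a b
  proof -
    have "(a, b) \<in> A \<times> B" using that subsetD[OF W(5)] by simp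
    then have "(a, b) \<in> ?P" by (rule subsetD[OF AB(5)])
    then show ?thesis using subsetD[OF interior_of_subset[of T V]] by simp
  qed
  ultimately show ?thesis by blast
qed

(* The sets u_nhd V w do form a base of neighbourhoods at zero of u_topology T. *)
lemma u_topology_nhd_zero_iff:
  assumes T: "locally_solid T"
  shows "0 \<in> u_topology T interior_of N \<longleftrightarrow>
    (\<exists>V w. solid_nhd T V \<and> 0 \<le> w \<and> w \<noteq> 0 \<and> u_nhd V w \<subseteq> N)" (is "?L \<longleftrightarrow> ?R")
proof
  assume ?L
  then obtain G where "u_open T G" "0 \<in> G" "G \<subseteq> N"
    by (auto simp: interior_of_def openin_u_topology)
  then obtain V w where "solid_nhd T V" "0 \<le> w" "w \<noteq> 0" "(+) 0 ` u_nhd V w \<subseteq> G"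
    unfolding u_open_def by blast
  moreover have "(+) 0 ` u_nhd V w = u_nhd V w" by (simp add: image_def)
  ultimately have "u_nhd V w \<subseteq> N" using \<open>G \<subseteq> N\<close> by (simp add: subset_iff)
  with \<open>solid_nhd T V\<close> \<open>0 \<le> w\<close> \<open>w \<noteq> 0\<close> show ?R by (intro exI conjI)
next
  assume ?R
  then obtain V w where Vw: "solid_nhd T V" "0 \<le> w" "w \<noteq> 0" "u_nhd V w \<subseteq> N" by blast
  have zero: "0 \<in> u_nhd W v" if "solid_nhd T W" "0 \<le> v" for W and v :: 'a
    using that subsetD[OF interior_of_subset[of T W]] by (simp add: u_nhd_def solid_nhd_def inf_absorb1)
  define G where
    "G = {x. \<exists>V w. solid_nhd T V \<and> 0 \<le> w \<and> w \<noteq> 0 \<and> (+) x ` u_nhd V w \<subseteq> N}"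
  have "u_open T G"
    unfolding u_open_def
  proof
    fix x assume "x \<in> G"
    then obtain V w where V: "solid_nhd T V" "0 \<le> w" "w \<noteq> 0" "(+) x ` u_nhd V w \<subseteq> N"
      unfolding G_def by blast
    obtain W where W: "solid_nhd T W" "\<forall>a\<in>W. \<forall>b\<in>W. a + b \<in> V"
      using solid_nhd_half[OF T V(1)] by metis
    have add: "y + z \<in> u_nhd V w" if "y \<in> u_nhd W w" "z \<in> u_nhd W w" for y z
    proof -
      let ?a = "inf \<bar>y\<bar> w" and ?b = "inf \<bar>z\<bar> w"
      have "inf \<bar>y + z\<bar> w \<le> inf (\<bar>y\<bar> + \<bar>z\<bar>) w"
        by (rule inf_mono[OF abs_triangle_ineq order_refl])
      also have "\<dots> \<le> ?a + ?b"
      proof -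
        have "w \<le> w + \<bar>z\<bar>" "w \<le> \<bar>y\<bar> + w" "w \<le> w + w" using V(2) by simp_all
        then have "inf (\<bar>y\<bar> + \<bar>z\<bar>) w \<le> w + \<bar>z\<bar>" "inf (\<bar>y\<bar> + \<bar>z\<bar>) w \<le> \<bar>y\<bar> + w"
             "inf (\<bar>y\<bar> + \<bar>z\<bar>) w \<le> w + w"
          by (simp_all only: le_infI2)
        then show ?thesis
          by (simp only: add_inf_distrib_left add_inf_distrib_right le_inf_iff inf_le1 simp_thms)
      qed
      finally have "inf \<bar>y + z\<bar> w \<le> ?a + ?b" .
      moreover have "0 \<le> inf \<bar>y + z\<bar> w" using V(2) by simp
      ultimately have "\<bar>inf \<bar>y + z\<bar> w\<bar> \<le> \<bar>?a + ?b\<bar>"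
        by (simp only: abs_of_nonneg order_trans[OF _ abs_ge_self])
      moreover have "?a + ?b \<in> V" using that W(2) by (simp add: u_nhd_def)
      ultimately show ?thesis
        using V(1) unfolding u_nhd_def solid_nhd_def solid_def by blast
    qed
    have "(+) x ` u_nhd W w \<subseteq> G"
    proof
      fix p assume "p \<in> (+) x ` u_nhd W w"
      then obtain y where y: "p = x + y" "y \<in> u_nhd W w" by blast
      have "(+) p ` u_nhd W w \<subseteq> (+) x ` u_nhd V w"
        using add[OF y(2)] unfolding y(1) add.assoc by blast
      then have "(+) p ` u_nhd W w \<subseteq> N" using V(4) by blast
      with W(1) V(2,3) show "p \<in> G"
        unfolding G_def by (intro CollectI exI conjI)
    qed
    with W(1) V(2,3) show "\<exists>V w. solid_nhd T V \<and> 0 \<le> w \<and> w \<noteq> 0 \<and> (+) x ` u_nhd V w \<subseteq> G"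
      by (intro exI conjI)
  qed
  moreover have "0 \<in> G"
  proof -
    have "(+) 0 ` u_nhd V w = u_nhd V w" by (simp add: image_def)
    with Vw have "(+) 0 ` u_nhd V w \<subseteq> N" by (simp only:)
    with Vw(1-3) show ?thesis unfolding G_def by (intro CollectI exI conjI)
  qed
  moreover have "G \<subseteq> N"
  proof
    fix x assume "x \<in> G"
    then obtain V w where "solid_nhd T V" "0 \<le> w" "(+) x ` u_nhd V w \<subseteq> N"
      unfolding G_def by blast
    then have "x + 0 \<in> N" using zero[of V w] by blast
    then show "x \<in> N" by simp
  qed
  ultimately show ?L
    unfolding interior_of_def openin_u_topology by blast
qed

definition band :: "'a::vector_lattice set \<Rightarrow> bool" where
  "band B \<longleftrightarrow> subspace B \<and> solid B \<and> (\<forall>A s. A \<subseteq> B \<and> isLub UNIV A s \<longrightarrow> s \<in> B)"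

definition weak_unit :: "'a::vector_lattice \<Rightarrow> bool" where
  "weak_unit e \<longleftrightarrow> e \<noteq> 0 \<and> 0 \<le> e \<and> band hull {e} = UNIV"

definition submetrizable_space :: "'a topology \<Rightarrow> bool" where
  "submetrizable_space T \<longleftrightarrow>
     (\<exists>S. metrizable_space S \<and> topspace S = topspace T \<and> (\<forall>U. openin S U \<longrightarrow> openin T U))"

end

theory Submission
  imports Defs
begin

text \<open>
  Metrizability of T yields solid neighbourhoods V n of zero that shrink to {0} and satisfy
  V (n + 1) + V (n + 1) + V (n + 1) \<subseteq> V n. For a weak unit e the neighbourhoods u_nhd (V n) e of
  the u-topology inherit the last property. They still intersect in {0}: if inf |x| e = 0,
  then the disjoint complement of x is a band containing e, hence contains x itself. A sequence
  of sets like this gives a translation invariant metric, by the chain construction of Frink.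
\<close>

section \<open>Frink's chain construction on an abelian group\<close>

text \<open>\<open>p\<close> is the entry at which the partial sums reach \<open>c\<close>. With
  \<open>c\<close> half the total, neither the entries before \<open>p\<close> nor those after it
  weigh more than half.\<close>

lemma sum_list_split_at:
  fixes f :: "'b \<Rightarrow> real"
  assumes "xs \<noteq> []" "\<And>x. 0 \<le> f x" "0 \<le> c" "c \<le> sum_list (map f xs)"
  shows "\<exists>ys p zs. xs = ys @ p # zs \<and> sum_list (map f ys) \<le> c \<and> c \<le> sum_list (map f ys) + f p"
  using assms(1,3,4)
proof (induction xs arbitrary: c)
  case (Cons a xs)
  show ?case
  proof (cases "c \<le> f a")
    case True
    with Cons.prems show ?thesis
      by (intro exI[of _ "[]"] exI[of _ a] exI[of _ xs]) simp
  next
    case False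
    with Cons.prems have "xs \<noteq> []" by auto
    moreover have "0 \<le> c - f a" "c - f a \<le> sum_list (map f xs)"
      using False Cons.prems by auto
    ultimately obtain ys p zs where "xs = ys @ p # zs" "sum_list (map f ys) \<le> c - f a"
        "c - f a \<le> sum_list (map f ys) + f p"
      using Cons.IH by blast
    then show ?thesis
      by (intro exI[of _ "a # ys"] exI[of _ p] exI[of _ zs]) simp
  qed
qed simp

text \<open>Frink's halving argument. Cutting at the entry that crosses half the total weight leaves
  two shorter lists of weight below \<open>(1/2) ^ Suc m\<close>, whose sums lie in
  \<open>U (Suc m)\<close> by induction, and the entry between them. This makes three summands,
  hence the threefold sum in \<open>add\<close>.\<close>

lemma chain_sum_mem:
  fixes U :: "nat \<Rightarrow> 'a::ab_group_add set"
  assumes zero: "\<And>n. 0 \<in> U n"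
    and add: "\<And>n x y z. x \<in> U (Suc n) \<Longrightarrow> y \<in> U (Suc n) \<Longrightarrow> z \<in> U (Suc n) \<Longrightarrow> x + y + z \<in> U n"
    and "\<forall>(x, n) \<in> set xs. x \<in> U n"
    and "(\<Sum>(x, n) \<leftarrow> xs. (1/2) ^ n) < (1/2 :: real) ^ m"
  shows "(\<Sum>(x, n) \<leftarrow> xs. x) \<in> U m"
  using assms(3,4)
proof (induction xs arbitrary: m rule: length_induct)
  case (1 xs)
  define f :: "'a \<times> nat \<Rightarrow> real" where "f = (\<lambda>(x, n). (1/2) ^ n)"
  have f: "0 \<le> f p" for p by (auto simp: f_def split: prod.split)
  have sum: "sum_list (map f xs) < (1/2) ^ m" using 1(3) by (simp only: f_def)
  have pos: "0 \<le> sum_list (map f ys)" for ys by (intro sum_list_nonneg) (auto simp: f)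
  have dec: "U (Suc n) \<subseteq> U n" for n using add[OF _ zero zero] by auto
  show ?case
  proof (cases "xs = []")
    case False
    obtain ys p zs where split: "xs = ys @ p # zs"
        "sum_list (map f ys) \<le> sum_list (map f xs) / 2"
        "sum_list (map f xs) / 2 \<le> sum_list (map f ys) + f p"
      using sum_list_split_at[OF False, of f "sum_list (map f xs) / 2"] f pos[of xs] by auto
    obtain x n where p: "p = (x, n)" by (cases p)
    have tot: "sum_list (map f xs) = sum_list (map f ys) + f p + sum_list (map f zs)"
      by (simp add: split(1))
    have "sum_list (map f ys) < (1/2) ^ Suc m" "sum_list (map f zs) < (1/2) ^ Suc m"
      using split(2,3) sum tot by auto
    then have "(\<Sum>(x, n) \<leftarrow> ys. x) \<in> U (Suc m)" "(\<Sum>(x, n) \<leftarrow> zs. x) \<in> U (Suc m)"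
      using 1(1,2) unfolding f_def by (auto simp: split(1))
    moreover have "x \<in> U (Suc m)"
    proof -
      \<comment> \<open>The cut entry may carry almost the whole weight, so halving says nothing
        about it. But its weight is a power of 1/2 strictly below \<open>(1/2) ^ m\<close>, which
        forces its index beyond \<open>m\<close>.\<close>
      have "f p < (1/2) ^ m" using sum tot pos[of ys] pos[of zs] by linarith
      then have "Suc m \<le> n" by (simp add: p f_def power_strict_decreasing_iff)
      then have "U n \<subseteq> U (Suc m)" using dec by (rule lift_Suc_antimono_le[rotated])
      then show ?thesis using 1(2) by (auto simp: split(1) p)
    qed
    ultimately have "(\<Sum>(x, n) \<leftarrow> ys. x) + x + (\<Sum>(x, n) \<leftarrow> zs. x) \<in> U m"
      by (intro add)
    then show ?thesis by (simp add: split(1) p add.assoc)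
  qed (simp add: zero)
qed

text \<open>The metric is \<open>p (y - x)\<close>, with \<open>p x\<close> the infimal weight of
  chains summing to \<open>x\<close>, cut off at 1. Concatenating chains gives the triangle
  inequality, negating their entries gives symmetry, and \<open>chain_sum_mem\<close> keeps
  \<open>p x\<close> positive for \<open>x \<noteq> 0\<close>. The one-sided estimate is what puts
  translates of \<open>U n\<close> inside balls.\<close>

lemma group_metric_exists:
  fixes U :: "nat \<Rightarrow> 'a::ab_group_add set"
  assumes zero: "(\<Inter>n. U n) = {0}"
    and minus: "\<And>n x. x \<in> U n \<Longrightarrow> - x \<in> U n"
    and add: "\<And>n x y z. x \<in> U (Suc n) \<Longrightarrow> y \<in> U (Suc n) \<Longrightarrow> z \<in> U (Suc n) \<Longrightarrow> x + y + z \<in> U n"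
  shows "\<exists>d. Metric_space UNIV d \<and> (\<forall>n x y. y - x \<in> U n \<longrightarrow> d x y \<le> (1/2) ^ n)"
proof -
  have zero': "0 \<in> U n" for n using zero by blast
  define w :: "('a \<times> nat) list \<Rightarrow> real" where "w xs = (\<Sum>(x, n) \<leftarrow> xs. (1/2) ^ n)" for xs
  \<comment> \<open>A chain splits \<open>x\<close> into increments, each tagged with the index of a
    set that contains it; the tag fixes its cost.\<close>
  define C where "C x = {xs. (\<forall>(y, n) \<in> set xs. y \<in> U n) \<and> (\<Sum>(y, n) \<leftarrow> xs. y) = x}" for x
  text \<open>The trivial bound 1 keeps the infimum meaningful where no chain reaches x.\<close>
  define p where "p x = Inf (insert 1 (w ` C x))" for x
  have w_nonneg: "0 \<le> w xs" for xs
    unfolding w_def by (intro sum_list_nonneg) auto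
  have bdd: "bdd_below (insert 1 (w ` C x))" for x
    using w_nonneg by (intro bdd_belowI[of _ 0]) auto
  have p_le1: "p x \<le> 1" for x
    unfolding p_def by (intro cInf_lower bdd) simp
  have p_le: "p x \<le> w xs" if "xs \<in> C x" for x xs
    unfolding p_def using that by (intro cInf_lower bdd) simp
  have p_nonneg: "0 \<le> p x" for x
    unfolding p_def using w_nonneg by (intro cInf_greatest) auto
  have p_U: "p x \<le> (1/2) ^ n" if "x \<in> U n" for x n
    using p_le[of "[(x, n)]" x] that by (simp add: C_def w_def)
  \<comment> \<open>The bound \<open>r \<le> 1\<close> excludes the inserted value 1, so what lies
    below \<open>r\<close> is the weight of a chain.\<close>
  have p_less: "\<exists>xs \<in> C x. w xs < r" if "p x < r" "r \<le> 1" for x r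
    using that cInf_lessD[of "insert 1 (w ` C x)" r] by (auto simp: p_def)
  have p_0: "p 0 = 0"
    using p_le[of "[]" 0] p_nonneg[of 0] by (simp add: C_def w_def)
  have p_eq_0: "x = 0" if "p x = 0" for x
  proof -
    have "x \<in> U n" for n
    proof -
      obtain xs where "xs \<in> C x" "w xs < (1/2) ^ n"
        using p_less[of x "(1/2) ^ n"] \<open>p x = 0\<close> by (auto simp: power_le_one)
      then show ?thesis
        using chain_sum_mem[of U xs n, OF zero' add] by (auto simp: C_def w_def)
    qed
    then show ?thesis using zero by blast
  qed
  have p_minus_le: "p (- x) \<le> p x" for x
  proof (rule field_le_epsilon)
    fix e :: real assume "0 < e"
    show "p (- x) \<le> p x + e"
    \<comment> \<open>Above 1 the trivial bound \<open>p_le1\<close> settles the claim; otherwise a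
      nearly optimal chain exists. Subadditivity is split in the same way.\<close>
    proof (cases "p x + e \<le> 1")
      case True
      then obtain xs where xs: "xs \<in> C x" "w xs < p x + e"
        using p_less[of x "p x + e"] \<open>0 < e\<close> by auto
      let ?xs = "map (\<lambda>(y, n). (- y, n)) xs"
      have "(\<Sum>(y, n) \<leftarrow> ?xs. y) = - (\<Sum>(y, n) \<leftarrow> xs. y)" "w ?xs = w xs"
        unfolding w_def by (induction xs) auto
      moreover have "\<forall>(y, n) \<in> set ?xs. y \<in> U n"
        using xs(1) minus by (auto simp: C_def)
      ultimately have "?xs \<in> C (- x)" using xs(1) by (simp add: C_def)
      from p_le[OF this] xs(2) \<open>w ?xs = w xs\<close> show ?thesis by simp
    qed (use p_le1[of "- x"] in simp)
  qed
  have p_minus: "p (- x) = p x" for x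
    using p_minus_le[of x] p_minus_le[of "- x"] by simp
  have p_add: "p (x + y) \<le> p x + p y" for x y
  proof (rule field_le_epsilon)
    fix e :: real assume "0 < e"
    show "p (x + y) \<le> p x + p y + e"
    proof (cases "p x + p y + e \<le> 1")
      case True
      then have "p x + e/2 \<le> 1" "p y + e/2 \<le> 1"
        using \<open>0 < e\<close> p_nonneg[of x] p_nonneg[of y] by auto
      then obtain xs ys where xs: "xs \<in> C x" "w xs < p x + e/2"
          and ys: "ys \<in> C y" "w ys < p y + e/2"
        using p_less[of x "p x + e/2"] p_less[of y "p y + e/2"] \<open>0 < e\<close> by auto
      have "xs @ ys \<in> C (x + y)" using xs(1) ys(1) by (auto simp: C_def)
      from p_le[OF this] xs(2) ys(2) show ?thesis by (simp add: w_def)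
    qed (use p_le1[of "x + y"] in simp)
  qed
  have "Metric_space UNIV (\<lambda>x y. p (y - x))"
  proof
    fix x y z
    show "p (y - x) = p (x - y)" using p_minus[of "x - y"] by simp
    show "p (z - x) \<le> p (y - x) + p (z - y)" using p_add[of "y - x" "z - y"] by simp
    show "p (y - x) = 0 \<longleftrightarrow> x = y" using p_eq_0[of "y - x"] p_0 by auto
  qed (rule p_nonneg)
  then show ?thesis using p_U by blast
qed

section \<open>Truncation at a positive element\<close>

text \<open>The right side is the infimum of the four sums \<open>a + b\<close>,
  \<open>a + w\<close>, \<open>w + b\<close> and \<open>w + w\<close>, of which the last three lie
  above \<open>w\<close>.\<close>

lemma inf_add_le:
  fixes a b w :: "'a::lattice_ab_group_add"
  assumes "0 \<le> a" "0 \<le> b" "0 \<le> w"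
  shows "inf (a + b) w \<le> inf a w + inf b w"
proof -
  have "w \<le> w + b" "w \<le> a + w" "w \<le> w + w" using assms by simp_all
  then have "inf (a + b) w \<le> w + b" "inf (a + b) w \<le> a + w" "inf (a + b) w \<le> w + w"
    by (simp_all only: le_infI2)
  then show ?thesis
    by (simp only: add_inf_distrib_left add_inf_distrib_right le_inf_iff inf_le1 simp_thms)
qed

lemma inf_abs_add_le:
  fixes x y w :: "'a::lattice_ab_group_add_abs"
  assumes "0 \<le> w"
  shows "inf \<bar>x + y\<bar> w \<le> inf \<bar>x\<bar> w + inf \<bar>y\<bar> w"
  using inf_mono[OF abs_triangle_ineq order_refl] inf_add_le[OF abs_ge_zero abs_ge_zero assms]
  by (rule order_trans)

text \<open>Passes the threefold sum property from \<open>T\<close> to the u-topology: truncation at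
  \<open>w\<close> is subadditive, and solidity of \<open>V\<close> absorbs the inequality.\<close>

lemma u_nhd_add:
  fixes w :: "'a::vector_lattice"
  assumes "solid V" "0 \<le> w" "\<And>a b c. a \<in> W \<Longrightarrow> b \<in> W \<Longrightarrow> c \<in> W \<Longrightarrow> a + b + c \<in> V"
    and "x \<in> u_nhd W w" "y \<in> u_nhd W w" "z \<in> u_nhd W w"
  shows "x + y + z \<in> u_nhd V w"
proof -
  let ?s = "inf \<bar>x\<bar> w + inf \<bar>y\<bar> w + inf \<bar>z\<bar> w"
  have "inf \<bar>x + y + z\<bar> w \<le> ?s"
    using inf_abs_add_le[OF assms(2), of "x + y" z] inf_abs_add_le[OF assms(2), of x y]
    by (meson add_right_mono order_trans)
  moreover have "0 \<le> inf \<bar>x + y + z\<bar> w" using assms(2) by simp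
  ultimately have "\<bar>inf \<bar>x + y + z\<bar> w\<bar> \<le> \<bar>?s\<bar>"
    by (simp only: abs_of_nonneg order_trans[OF _ abs_ge_self])
  moreover have "?s \<in> V" using assms(3-6) by (simp add: u_nhd_def)
  ultimately show ?thesis
    using assms(1) unfolding u_nhd_def solid_def by blast
qed

section \<open>Shrinking solid neighbourhoods in a metrizable topology\<close>

lemma solid_nhd_zero: "solid_nhd T V \<Longrightarrow> 0 \<in> V"
  using subsetD[OF interior_of_subset[of T V]] by (simp add: solid_nhd_def)

lemma solid_nhd_subset:
  assumes "locally_solid T" "openin T G" "0 \<in> G"
  shows "\<exists>V. solid_nhd T V \<and> V \<subseteq> G"
proof -
  obtain U V where "openin T U" "solid V" "0 \<in> U" "U \<subseteq> V" "V \<subseteq> G"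
    using assms unfolding locally_solid_def neighbourhood_base_at_def by metis
  then show ?thesis
    unfolding solid_nhd_def using interior_of_maximal[of U V T] by blast
qed

text \<open>Dependent choice. Halving twice makes room for threefold sums, and intersecting with a
  solid neighbourhood inside the next ball around 0 shrinks the sequence to
  \<open>{0}\<close>.\<close>

lemma metrizable_solid_nhd_sequence:
  fixes T :: "'a::vector_lattice topology"
  assumes T: "locally_solid T" and "metrizable_space T"
  obtains V where "\<And>n. solid_nhd T (V n)" "(\<Inter>n. V n) = {0}"
    "\<And>n a b c. a \<in> V (Suc n) \<Longrightarrow> b \<in> V (Suc n) \<Longrightarrow> c \<in> V (Suc n) \<Longrightarrow> a + b + c \<in> V n"
proof -
  obtain M d where "Metric_space M d" and Td: "T = Metric_space.mtopology M d"
    using assms(2) unfolding metrizable_space_def by blast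
  then interpret Metric_space M d by simp
  have M: "x \<in> M" for x
    using T Td by (simp add: locally_solid_def linear_topology_def)
  define B where "B n = mball 0 (inverse (Suc n))" for n
  have B: "openin T (B n)" "0 \<in> B n" for n
    by (simp_all add: B_def Td M)
  have "\<exists>V. \<forall>n. (solid_nhd T (V n) \<and> V n \<subseteq> B n) \<and>
      (\<forall>a\<in>V (Suc n). \<forall>b\<in>V (Suc n). \<forall>c\<in>V (Suc n). a + b + c \<in> V n)"
  proof (rule dependent_nat_choice)
    show "\<exists>V. solid_nhd T V \<and> V \<subseteq> B 0"
      using solid_nhd_subset[OF T B] .
  next
    fix V n assume "solid_nhd T V \<and> V \<subseteq> B n"
    then obtain W where W: "solid_nhd T W" "\<forall>a\<in>W. \<forall>b\<in>W. a + b \<in> V"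
      using solid_nhd_half[OF T] by blast
    obtain W' where W': "solid_nhd T W'" "\<forall>a\<in>W'. \<forall>b\<in>W'. a + b \<in> W"
      using solid_nhd_half[OF T W(1)] by blast
    obtain D where D: "solid_nhd T D" "D \<subseteq> B (Suc n)"
      using solid_nhd_subset[OF T B] by blast
    \<comment> \<open>Adding 0 gives the inclusion; the third summand then counts as an element of
      \<open>W\<close> next to \<open>a + b\<close>.\<close>
    have "W' \<subseteq> W" using W'(2) solid_nhd_zero[OF W'(1)] by force
    then have "\<forall>a\<in>W' \<inter> D. \<forall>b\<in>W' \<inter> D. \<forall>c\<in>W' \<inter> D. a + b + c \<in> V"
      using W(2) W'(2) by blast
    then show "\<exists>W. (solid_nhd T W \<and> W \<subseteq> B (Suc n)) \<and>
        (\<forall>a\<in>W. \<forall>b\<in>W. \<forall>c\<in>W. a + b + c \<in> V)"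
      using solid_nhd_Int[OF W'(1) D(1)] D(2) by blast
  qed
  then obtain V where V: "\<And>n. solid_nhd T (V n)" "\<And>n. V n \<subseteq> B n"
      "\<And>n a b c. a \<in> V (Suc n) \<Longrightarrow> b \<in> V (Suc n) \<Longrightarrow> c \<in> V (Suc n) \<Longrightarrow> a + b + c \<in> V n"
    by blast
  have "x = 0" if "\<And>n. x \<in> V n" for x
  proof (rule ccontr)
    assume "x \<noteq> 0"
    then have "0 < d 0 x" by (simp add: M)
    then obtain n where "inverse (Suc n) < d 0 x" using reals_Archimedean by blast
    moreover have "d 0 x < inverse (Suc n)"
      using that[of n] V(2)[of n] by (auto simp: B_def)
    ultimately show False by simp
  qed
  then have "(\<Inter>n. V n) = {0}" using solid_nhd_zero[OF V(1)] by blast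
  with V(1) show thesis using V(3) by (rule that)
qed

section \<open>Disjoint complements are bands\<close>

definition disjoint_complement :: "'a::vector_lattice \<Rightarrow> 'a set" where
  "disjoint_complement x = {y. inf \<bar>y\<bar> \<bar>x\<bar> = 0}"

lemma disjoint_complement_iff:
  "y \<in> disjoint_complement x \<longleftrightarrow> inf \<bar>y\<bar> \<bar>x\<bar> \<le> 0"
  by (simp add: disjoint_complement_def order.eq_iff)

lemma solid_disjoint_complement: "solid (disjoint_complement x)"
  unfolding solid_def disjoint_complement_iff by (blast intro: order_trans[OF inf_mono[OF _ order_refl]])

lemma disjoint_complement_add:
  assumes "y \<in> disjoint_complement x" "z \<in> disjoint_complement x"
  shows "y + z \<in> disjoint_complement x"
  using inf_abs_add_le[of "\<bar>x\<bar>" y z] assms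
  unfolding disjoint_complement_iff[of "y + z"] by (simp add: disjoint_complement_def)

text \<open>Reduces real scalars to natural ones. The outer absolute value on the right gives the
  inequality the shape that \<open>solid\<close> asks for.\<close>

lemma abs_scaleR_le:
  fixes y :: "'a::vector_lattice"
  assumes "\<bar>c\<bar> \<le> r"
  shows "\<bar>c *\<^sub>R y\<bar> \<le> \<bar>r *\<^sub>R \<bar>y\<bar>\<bar>"
proof -
  \<comment> \<open>Stated for every \<open>c\<close> so that it also applies to \<open>- c\<close>;
    the two instances bound the absolute value.\<close>
  have *: "c *\<^sub>R y \<le> r *\<^sub>R \<bar>y\<bar>" if "\<bar>c\<bar> \<le> r" for c
  proof (cases "0 \<le> c")
    case True
    then have "c *\<^sub>R y \<le> c *\<^sub>R \<bar>y\<bar>" by (intro scaleR_left_mono abs_ge_self)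
    also have "\<dots> \<le> r *\<^sub>R \<bar>y\<bar>" using that by (intro scaleR_right_mono) auto
    finally show ?thesis .
  next
    case False
    then have "(- c) *\<^sub>R (- y) \<le> (- c) *\<^sub>R \<bar>y\<bar>"
      by (intro scaleR_left_mono abs_ge_minus_self) auto
    also have "\<dots> \<le> r *\<^sub>R \<bar>y\<bar>" using that by (intro scaleR_right_mono) auto
    finally show ?thesis by simp
  qed
  have "\<bar>c *\<^sub>R y\<bar> \<le> r *\<^sub>R \<bar>y\<bar>"
    using *[of c] *[of "- c"] assms by (intro abs_leI) auto
  then show ?thesis using abs_ge_self order_trans by blast
qed

lemma subspace_disjoint_complement: "subspace (disjoint_complement x)"
proof (rule subspaceI)
  show zero: "0 \<in> disjoint_complement x" by (simp add: disjoint_complement_def inf_absorb1)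
  fix y c assume y: "y \<in> disjoint_complement x"
  \<comment> \<open>Closure under addition yields natural multiples; solidity and the Archimedean
    property extend this to real scalars.\<close>
  have "real n *\<^sub>R \<bar>y\<bar> \<in> disjoint_complement x" for n
  proof (induction n)
    case (Suc n)
    have "\<bar>y\<bar> \<in> disjoint_complement x" using y by (simp add: disjoint_complement_def)
    from disjoint_complement_add[OF this Suc] show ?case by (simp add: scaleR_left_distrib)
  qed (simp add: zero)
  moreover obtain n where "\<bar>c\<bar> \<le> real n" using real_arch_simple by blast
  ultimately show "c *\<^sub>R y \<in> disjoint_complement x"
    using abs_scaleR_le solid_disjoint_complement unfolding solid_def by blast
qed (rule disjoint_complement_add)

text \<open>The set \<open>A\<close> may contain elements of any sign, so the two parts of
  \<open>s\<close> are treated apart. The negative part lies below \<open>\<bar>a\<bar>\<close> for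
  any \<open>a \<in> A\<close>; the positive part needs that \<open>s\<close> is least.\<close>

lemma disjoint_complement_isLub:
  fixes x :: "'a::vector_lattice"
  assumes A: "A \<subseteq> disjoint_complement x" and s: "isLub UNIV A s"
  shows "s \<in> disjoint_complement x"
proof -
  have ub: "a \<le> s" if "a \<in> A" for a using s that by (auto simp: isLub_def leastP_def isUb_def setle_def)
  have least: "s \<le> u" if "\<And>a. a \<in> A \<Longrightarrow> a \<le> u" for u
    using s that by (auto simp: isLub_def leastP_def isUb_def setle_def setge_def)
  have solid: "y \<in> disjoint_complement x" if "\<bar>y\<bar> \<le> \<bar>z\<bar>" "z \<in> disjoint_complement x" for y z
    using solid_disjoint_complement that unfolding solid_def by blast
  \<comment> \<open>The overlap of the positive part of \<open>s\<close> with
    \<open>\<bar>x\<bar>\<close>. Subtracting it from \<open>sup s 0\<close> still leaves an upper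
    bound of \<open>A\<close>, so it must vanish.\<close>
  define z where "z = inf (sup s 0) \<bar>x\<bar>"
  have z: "0 \<le> z" "z \<le> sup s 0" "z \<le> \<bar>x\<bar>" by (simp_all add: z_def)
  have "a \<le> sup s 0 - z" if "a \<in> A" for a
  proof -
    have "inf (sup a 0) z \<le> inf \<bar>a\<bar> \<bar>x\<bar>"
      using z by (intro inf_mono sup_least) (auto simp: abs_ge_self)
    also have "\<dots> = 0" using A that by (auto simp: disjoint_complement_def)
    finally have "inf (sup a 0) z = 0" using z(1) by (intro order.antisym) auto
    \<comment> \<open>Disjoint elements have their supremum as sum, and both \<open>sup a 0\<close>
      and \<open>z\<close> lie below \<open>sup s 0\<close>.\<close>
    then have "sup a 0 + z = sup (sup a 0) z"
      using add_eq_inf_sup[of "sup a 0" z] by simp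
    also have "\<dots> \<le> sup s 0" using z ub[OF that] by (auto intro: le_supI1)
    finally have "sup a 0 \<le> sup s 0 - z" by (simp add: le_diff_eq)
    then show ?thesis by simp
  qed
  then have "s \<le> sup s 0 - z" by (rule least)
  moreover have "0 \<le> sup s 0 - z" using z(2) by (simp only: diff_ge_0_iff_ge)
  ultimately have "sup s 0 \<le> sup s 0 - z" by (rule sup_least)
  then have "z = 0" using z(1) by (simp add: le_diff_eq)
  then have pos: "sup s 0 \<in> disjoint_complement x"
    by (simp add: disjoint_complement_def z_def)
  have neg: "sup (- s) 0 \<in> disjoint_complement x"
  proof (cases "A = {}")
    case True
    text \<open>A supremum of the empty set is a least element, so the space is trivial.\<close>
    then have "s \<le> u" for u using least by simp
    from this[of "s + s"] have "sup (- s) 0 = 0" by (simp add: sup_absorb2)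
    then show ?thesis using subspace_0[OF subspace_disjoint_complement] by simp
  next
    case False
    then obtain a where a: "a \<in> A" by blast
    have "- s \<le> \<bar>a\<bar>" using ub[OF a] abs_ge_minus_self[of a] by (meson neg_le_iff_le order_trans)
    then have "\<bar>sup (- s) 0\<bar> \<le> \<bar>a\<bar>" by (simp add: abs_of_nonneg)
    then show ?thesis using solid a A by blast
  qed
  have "\<bar>s\<bar> \<le> sup s 0 + sup (- s) 0"
    by (intro abs_leI) (auto intro: add_increasing add_increasing2)
  then have "\<bar>s\<bar> \<le> \<bar>sup s 0 + sup (- s) 0\<bar>" using abs_ge_self order_trans by blast
  then show ?thesis using solid disjoint_complement_add[OF pos neg] by blast
qed

lemma band_disjoint_complement: "band (disjoint_complement x)"
  unfolding band_def
  using subspace_disjoint_complement solid_disjoint_complement disjoint_complement_isLub by blast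

lemma weak_unit_inf_eq_0:
  assumes "weak_unit e" "inf \<bar>x\<bar> e = 0"
  shows "x = 0"
proof -
  have "\<bar>e\<bar> = e" using assms(1) by (simp add: weak_unit_def)
  then have "{e} \<subseteq> disjoint_complement x"
    using assms(2) by (simp add: disjoint_complement_def inf_commute)
  then have "band hull {e} \<subseteq> disjoint_complement x"
    by (rule hull_minimal) (rule band_disjoint_complement)
  then have "x \<in> disjoint_complement x" using assms(1) by (auto simp: weak_unit_def)
  then show ?thesis by (simp add: disjoint_complement_def)
qed

section \<open>A metric topology below the u-topology\<close>

theorem proposition6:
  fixes T :: "'a::vector_lattice topology"
  assumes "locally_solid T"
    and "metrizable_space T"
    and "\<exists>e::'a. weak_unit e"
  shows "submetrizable_space (u_topology T)"
proof -
  obtain e :: 'a where e: "weak_unit e" using assms(3) by blast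
  then have e0: "0 \<le> e" "e \<noteq> 0" by (simp_all add: weak_unit_def)
  obtain V where V: "\<And>n. solid_nhd T (V n)" "(\<Inter>n. V n) = {0}"
      "\<And>n a b c. a \<in> V (Suc n) \<Longrightarrow> b \<in> V (Suc n) \<Longrightarrow> c \<in> V (Suc n) \<Longrightarrow> a + b + c \<in> V n"
    using metrizable_solid_nhd_sequence[OF assms(1,2)] by blast
  let ?U = "\<lambda>n. u_nhd (V n) e"
  have "\<exists>d. Metric_space UNIV d \<and> (\<forall>n x y. y - x \<in> ?U n \<longrightarrow> d x y \<le> (1/2) ^ n)"
  proof (rule group_metric_exists)
    have "x \<in> (\<Inter>n. ?U n) \<longleftrightarrow> inf \<bar>x\<bar> e \<in> (\<Inter>n. V n)" for x
      by (simp add: u_nhd_def)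
    then have "x \<in> (\<Inter>n. ?U n) \<longleftrightarrow> inf \<bar>x\<bar> e = 0" for x
      unfolding V(2) by simp
    \<comment> \<open>Here the weak unit separates points: truncation at \<open>e\<close> alone
      detects every nonzero element.\<close>
    moreover have "inf \<bar>x\<bar> e = 0 \<longleftrightarrow> x = 0" for x
      using weak_unit_inf_eq_0[OF e, of x] e0(1) by (auto simp: inf_absorb1)
    ultimately show "(\<Inter>n. ?U n) = {0}" by blast
  next
    fix n x y z assume "x \<in> ?U (Suc n)" "y \<in> ?U (Suc n)" "z \<in> ?U (Suc n)"
    then show "x + y + z \<in> ?U n"
      using u_nhd_add[OF _ e0(1) V(3)] V(1) unfolding solid_nhd_def by blast
  qed (simp add: u_nhd_def)
  then obtain d where "Metric_space UNIV d"
      and d: "\<And>n x y. y - x \<in> ?U n \<Longrightarrow> d x y \<le> (1/2) ^ n"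
    by blast
  then interpret Metric_space UNIV d by simp
  have "u_open T G" if "openin mtopology G" for G
    unfolding u_open_def
  proof
    fix x assume "x \<in> G"
    then obtain r where r: "0 < r" "mball x r \<subseteq> G"
      using \<open>openin mtopology G\<close> by (auto simp: openin_mtopology)
    then obtain n where n: "(1/2) ^ n < r" using real_arch_pow_inv[of r "1/2"] by auto
    \<comment> \<open>The translate lies in the ball around \<open>x\<close>: its points differ from
      \<open>x\<close> by an element of \<open>?U n\<close>, so their distance from \<open>x\<close>
      is below \<open>r\<close>.\<close>
    have "(+) x ` ?U n \<subseteq> G"
    proof
      fix y assume "y \<in> (+) x ` ?U n"
      then have "d x y \<le> (1/2) ^ n" by (auto intro: d)
      then show "y \<in> G" using n r(2) by auto
    qed
    with V(1) e0 show "\<exists>V w. solid_nhd T V \<and> 0 \<le> w \<and> w \<noteq> 0 \<and> (+) x ` u_nhd V w \<subseteq> G"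
      by blast
  qed
  then have finer: "openin (u_topology T) G" if "openin mtopology G" for G
    using that by (simp add: openin_u_topology)
  \<comment> \<open>The whole space is open in the metric topology, hence in the u-topology. The
    empty carrier of the zero space cannot occur, since \<open>e \<noteq> 0\<close>.\<close>
  have "topspace (u_topology T) = UNIV"
    using openin_subset[OF finer[OF openin_topspace]] by auto
  with finer show ?thesis
    unfolding submetrizable_space_def
    by (intro exI[of _ mtopology]) (simp add: metrizable_space_mtopology)
qed

end
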